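(* Let $a<\xi<b$ be real numbers with $b-\xi<\xi-a$, and let $n\ge 1$ and $\nu\ge 0$ be integers with $\frac{a-\xi+n(b-\xi)}{b-a}<\nu\le \frac n2$. Put $h=\frac{b-\xi}{\nu+1}$ and define nodes $a_0,a_1,\dots,a_n$ by $$a_0=\xi,\qquad a_{2j-1}=\xi+jh,\quad a_{2j}=\xi-jh\quad (1\le j\le \nu),\qquad a_{\nu+j}=\xi-jh\quad(\nu+1\le j\le n-\nu),$$ so that in particular $a_n=\xi-(n-\nu)h$ when $n>2\nu$. Let $l_i(x)=\prod_{0\le j\le n,\ j\ne i}\frac{x-a_j}{a_i-a_j}$ $(0\le i\le n)$ be the Lagrange fundamental polynomials at these nodes, and set $A_i^{(k)}=\frac{l_i^{(k)}(\xi)}{k!}$. For $r\ge1$ let $$\eta_r=\frac{-1}{h^r}\Big[\sum_{j=1}^{\nu}\frac1{j^r}+\sum_{j=1}^{n-\nu}\frac{1}{(-j)^r}\Big].$$ Then, for every integer $k\ge 1$, $$A_0^{(k)}=Z_k(\eta_r);$$ for $i=1,2,\dots,\nu$, $$A_{2i-1}^{(k)}=\frac{(-1)^{i-1}\,\nu!\,(n-\nu)!}{h\,i\,(\nu-i)!\,(n-\nu+i)!}\,Z_{k-1}\Big(\eta_r+\frac{1}{h^r i^r}\Big),$$ $$A_{2i}^{(k)}=\frac{(-1)^{i}\,\nu!\,(n-\nu)!}{h\,i\,(\nu+i)!\,(n-\nu-i)!}\,Z_{k-1}\Big(\eta_r+\frac{1}{h^r(-i)^r}\Big);$$ and for $i=\nu+1,\nu+2,\dots,n-\nu$,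 $$A_{\nu+i}^{(k)}=\frac{(-1)^{i}\,\nu!\,(n-\nu)!}{h\,i\,(\nu+i)!\,(n-\nu-i)!}\,Z_{k-1}\Big(\eta_r+\frac{1}{h^r(-i)^r}\Big).$$
   Context: For $N\ge1$, $Z_N$ denotes the cycle index of the symmetric group of degree $N$, i.e. the polynomial $$Z_N(x_1,\dots,x_N)=\frac1{N!}\sum_{\sigma\in \mathfrak S_N}x_1^{c_1(\sigma)}\cdots x_N^{c_N(\sigma)}=\sum\frac{x_1^{e_1}\cdots x_N^{e_N}}{1^{e_1}e_1!\,2^{e_2}e_2!\cdots N^{e_N}e_N!},$$ where $c_i(\sigma)$ is the number of cycles of length $i$ in $\sigma$ and the last sum runs over all $(e_1,\dots,e_N)$ of nonnegative integers with $e_1+2e_2+\cdots+Ne_N=N$; by convention $Z_0=1$. Given a sequence of quantities $x_r$ depending on $r=1,2,\dots$, the notation $Z_N(x_r)$ means $Z_N(x_1,x_2,\dots,x_N)$; thus for example $Z_{k-1}\big(\eta_r+\frac1{h^ri^r}\big)$ means $Z_{k-1}(x_1,\dots,x_{k-1})$ with $x_r=\eta_r+\frac{1}{h^ri^r}$. *)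

theory Defs
  imports "HOL-Analysis.Analysis" "HOL-Combinatorics.Orbits"
begin

text \<open>
  For a permutation \<open>\<sigma>\<close> of \<open>{1..N}\<close>, the cycles (fixed points included) are identified with
  the orbits of \<open>\<sigma>\<close> on \<open>{1..N}\<close>.
\<close>

definition cycle_count :: "nat \<Rightarrow> (nat \<Rightarrow> nat) \<Rightarrow> nat \<Rightarrow> nat" where
  "cycle_count N \<sigma> i = card {C. (\<exists>m\<in>{1..N}. C = orbit \<sigma> m) \<and> card C = i}"

text \<open>
  The cycle index of the symmetric group of degree \<open>N\<close>, evaluated at \<open>(x 1, \<dots>, x N)\<close>; for
  \<open>N = 0\<close> the identity is the only permutation of the empty set, so the value is \<open>1\<close>.
\<close>

definition cycle_index :: "nat \<Rightarrow> (nat \<Rightarrow> real) \<Rightarrow> real" where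
  "cycle_index N x =
     1 / fact N * (\<Sum>\<sigma> | \<sigma> permutes {1..N}. \<Prod>i=1..N. x i ^ cycle_count N \<sigma> i)"

definition lagrange_fundamental :: "(nat \<Rightarrow> real) \<Rightarrow> nat \<Rightarrow> nat \<Rightarrow> real \<Rightarrow> real" where
  "lagrange_fundamental node n i x =
     (\<Prod>j\<in>{0..n} - {i}. (x - node j) / (node i - node j))"

definition lagrange_coeff :: "(nat \<Rightarrow> real) \<Rightarrow> nat \<Rightarrow> real \<Rightarrow> nat \<Rightarrow> nat \<Rightarrow> real" where
  "lagrange_coeff node n \<xi> i k =
     (deriv ^^ k) (lagrange_fundamental node n i) \<xi> / fact k"

end

theory Submission
  imports Defs "HOL-Computational_Algebra.Polynomial_FPS"
begin

text \<open>
  Around \<open>t = 0\<close>, where \<open>t = x - \<xi>\<close>, the fundamental polynomial at \<open>\<xi>\<close> is the product of the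
  factors \<open>1 - t / d\<close> over the offsets \<open>d\<close> of the other nodes from \<open>\<xi>\<close>. For a node with offset
  \<open>e \<noteq> 0\<close>, the factor coming from \<open>\<xi>\<close> itself is \<open>t / e\<close>, and every further factor
  \<open>(t - d) / (e - d)\<close> equals \<open>d / (d - e) \<cdot> (1 - t / d)\<close>; so up to a constant it is \<open>t\<close> times a
  product of the same shape in which \<open>e\<close> is left out. Hence everything rests on one expansion:
  the coefficient of \<open>t ^ k\<close> in \<open>\<Prod>j. (1 - u j * t)\<close> is the cycle index of degree \<open>k\<close> at
  \<open>x r = - (\<Sum>j. u j ^ r)\<close> (\<open>coeff_prod_linear_eq_cycle_index\<close>). Leaving out the offset \<open>e\<close>
  adds \<open>1 / e ^ r\<close> to \<open>x r\<close>, which explains the shifted arguments.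

  Both sides of that expansion satisfy \<open>m * Z m = (\<Sum>r=1..m. x r * Z (m - r))\<close> with \<open>Z 0 = 1\<close>.
  For the product this is its logarithmic derivative, compared coefficientwise
  (\<open>fps_deriv_prod_linear\<close>). For the cycle index it classifies permutations by the length \<open>r\<close> of
  the cycle through a chosen point. To avoid counting these cycles directly, that cycle is
  contracted one point at a time: a permutation of \<open>insert a A\<close> is a permutation of \<open>A\<close> into
  which \<open>a\<close> has been inserted, either as a fixed point or just in front of some \<open>b\<close> in the cycle
  of \<open>b\<close>. Keeping track of how many points have been removed from the distinguished cycle gives
  the recursion \<open>rooted_cycle_sum_rec\<close>, which is solved in \<open>cycle_sum_eq_fact_mult\<close>.

  For equidistant nodes the offsets are \<open>c * h\<close> with \<open>c\<close> in an integer interval around \<open>0\<close>, and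
  the constants become quotients of factorials. One formula in \<open>c\<close> covers the nodes on both
  sides of \<open>\<xi>\<close>.
\<close>

section \<open>Inserting a point into a cycle\<close>

text \<open>
  Since \<open>\<tau>\<close> fixes \<open>a\<close>, the composite sends \<open>a\<close> to \<open>b\<close> and redirects the predecessor of \<open>b\<close> to
  \<open>a\<close>: the point \<open>a\<close> is spliced into the cycle just in front of \<open>b\<close>.
\<close>

lemma orbit_transpose_comp_new:
  assumes \<tau>: "\<tau> permutes A" and fin: "finite A" and a: "a \<notin> A" and b: "b \<in> A"
  shows "orbit (Transposition.transpose a b \<circ> \<tau>) a = insert a (orbit \<tau> b)"
proof -
  define \<sigma> where "\<sigma> = Transposition.transpose a b \<circ> \<tau>"
  have \<tau>a: "\<tau> a = a"
    using \<tau> a by (rule permutes_not_in)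
  have \<sigma>a: "\<sigma> a = b"
    by (simp add: \<sigma>_def \<tau>a)
  have "\<sigma> permutes insert a A"
    unfolding \<sigma>_def using \<tau> b
    by (intro permutes_compose permutes_imp_permutes_insert permutes_swap_id) auto
  then have perm_\<sigma>: "permutation \<sigma>"
    using fin by (auto simp: permutation_permutes)
  have perm_\<tau>: "permutation \<tau>"
    using \<tau> fin by (auto simp: permutation_permutes)
  \<comment> \<open>Along the cycle of \<open>b\<close> the two maps differ only at the predecessor of \<open>b\<close>.\<close>
  have \<sigma>_cases: "\<sigma> y = (if \<tau> y = b then a else \<tau> y)" if "y \<in> orbit \<tau> b" for y
  proof -
    have "\<tau> y \<in> A"
      using permutes_orbit_subset[OF \<tau> b] that by (auto simp: permutes_in_image[OF \<tau>])
    then show ?thesis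
      using a by (auto simp: \<sigma>_def Transposition.transpose_def)
  qed
  have "y \<in> insert a (orbit \<tau> b)" if "y \<in> orbit \<sigma> a" for y
    using that
  proof induction
    case base
    then show ?case
      using permutation_self_in_orbit[OF perm_\<tau>, of b] by (simp add: \<sigma>a)
  next
    case (step y)
    then show ?case
      using permutation_self_in_orbit[OF perm_\<tau>, of b] orbit.step[of y \<tau> b]
      by (auto simp: \<sigma>a \<sigma>_cases)
  qed
  moreover have b_in: "b \<in> orbit \<sigma> a"
    using orbit.base[of \<sigma> a] by (simp add: \<sigma>a)
  have \<tau>_in: "\<tau> y \<in> orbit \<sigma> a" if "y \<in> orbit \<tau> b" "y \<in> orbit \<sigma> a" for y
    using \<sigma>_cases[OF that(1)] orbit.step[OF that(2)] b_in by (auto split: if_splits)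
  have "y \<in> orbit \<sigma> a" if "y \<in> orbit \<tau> b" for y
    using that
  proof induction
    case base
    then show ?case
      using \<tau>_in[OF permutation_self_in_orbit[OF perm_\<tau>] b_in] .
  next
    case (step y)
    then show ?case
      by (rule \<tau>_in)
  qed
  moreover have "a \<in> orbit \<sigma> a"
    by (rule permutation_self_in_orbit[OF perm_\<sigma>])
  ultimately show ?thesis
    unfolding \<sigma>_def by blast
qed

text \<open>The transposition only affects arrows into \<open>a\<close> or \<open>b\<close>, and this cycle contains neither.\<close>

lemma orbit_transpose_comp_old:
  assumes \<tau>: "\<tau> permutes A" and fin: "finite A" and a: "a \<notin> A"
    and c: "c \<in> A" "c \<notin> orbit \<tau> b"
  shows "orbit (Transposition.transpose a b \<circ> \<tau>) c = orbit \<tau> c"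
proof (rule orbit_cong)
  have perm_\<tau>: "permutation \<tau>"
    using \<tau> fin by (auto simp: permutation_permutes)
  then show self: "c \<in> orbit \<tau> c"
    by (rule permutation_self_in_orbit)
  fix y assume y: "y \<in> orbit \<tau> c"
  then have "\<tau> y \<in> orbit \<tau> c"
    by (rule orbit.step)
  moreover have "b \<notin> orbit \<tau> c"
    using c(2) orbit_swap[OF self] by blast
  moreover have "a \<notin> orbit \<tau> c"
    using permutes_orbit_subset[OF \<tau> c(1)] a by blast
  ultimately have "\<tau> y \<noteq> a" "\<tau> y \<noteq> b"
    by auto
  then show "(Transposition.transpose a b \<circ> \<tau>) y = \<tau> y"
    by (simp add: Transposition.transpose_def)
qed

text \<open>
  The orbit of \<open>a\<close> takes the place of the orbit of \<open>b\<close>; with these two set aside, the families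
  of cycles before and after the insertion agree, so products over them can be exchanged.
\<close>

lemma other_orbits_transpose_comp:
  assumes \<tau>: "\<tau> permutes A" and fin: "finite A" and a: "a \<notin> A" and b: "b \<in> A"
  defines "\<sigma> \<equiv> Transposition.transpose a b \<circ> \<tau>"
  shows "orbit \<sigma> ` A - {orbit \<sigma> a} = orbit \<tau> ` A - {orbit \<tau> b}"
proof -
  have perm_\<tau>: "permutation \<tau>"
    using \<tau> fin by (auto simp: permutation_permutes)
  have "\<sigma> permutes insert a A"
    unfolding \<sigma>_def using \<tau> b
    by (intro permutes_compose permutes_imp_permutes_insert permutes_swap_id) auto
  then have perm_\<sigma>: "permutation \<sigma>"
    using fin by (auto simp: permutation_permutes)
  have new: "orbit \<sigma> a = insert a (orbit \<tau> b)"
    unfolding \<sigma>_def using assms by (intro orbit_transpose_comp_new)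
  have old: "orbit \<sigma> c = orbit \<tau> c" if "c \<in> A" "c \<notin> orbit \<tau> b" for c
    unfolding \<sigma>_def using assms that by (intro orbit_transpose_comp_old)
  have same: "orbit \<sigma> c = orbit \<sigma> a \<longleftrightarrow> orbit \<tau> c = orbit \<tau> b" if c: "c \<in> A" for c
  proof (cases "c \<in> orbit \<tau> b")
    case True
    then show ?thesis
      using new orbit_cyclic_eq3[OF cyclic_on_orbit'[OF perm_\<tau>], of c b]
        orbit_cyclic_eq3[OF cyclic_on_orbit'[OF perm_\<sigma>], of c a] by blast
  next
    case False
    then have "orbit \<tau> c \<noteq> orbit \<tau> b"
      using permutation_self_in_orbit[OF perm_\<tau>, of c] by auto
    moreover have "a \<notin> orbit \<tau> c"
      using permutes_orbit_subset[OF \<tau> c] a by blast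
    ultimately show ?thesis
      using old[OF c False] new by auto
  qed
  have "c \<notin> orbit \<tau> b" if "orbit \<tau> c \<noteq> orbit \<tau> b" for c
    using that orbit_cyclic_eq3[OF cyclic_on_orbit'[OF perm_\<tau>], of c b] by blast
  then show ?thesis
    using same old by (auto simp: image_iff; metis)
qed

section \<open>Sums over permutations weighted by cycle type\<close>

text \<open>
  Up to the factor \<open>1 / fact (card A)\<close> this is the cycle index, stated for an arbitrary ground
  set because the recursion deletes arbitrary points.
\<close>

definition cycle_sum :: "(nat \<Rightarrow> 'b::comm_semiring_1) \<Rightarrow> 'a set \<Rightarrow> 'b" where
  "cycle_sum x A = (\<Sum>\<sigma> | \<sigma> permutes A. \<Prod>C\<in>orbit \<sigma> ` A. x (card C))"

text \<open>
  The cycle through the root \<open>a\<close> is weighted as if it were \<open>s\<close> points longer; \<open>s\<close> records the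
  points that have already been contracted into the root.
\<close>

definition rooted_cycle_sum ::
    "(nat \<Rightarrow> 'b::comm_semiring_1) \<Rightarrow> 'a set \<Rightarrow> 'a \<Rightarrow> nat \<Rightarrow> 'b" where
  "rooted_cycle_sum x A a s =
     (\<Sum>\<sigma> | \<sigma> permutes insert a A.
        x (card (orbit \<sigma> a) + s) * (\<Prod>C\<in>orbit \<sigma> ` A - {orbit \<sigma> a}. x (card C)))"

lemma cycle_sum_insert:
  assumes "finite A"
  shows "cycle_sum x (insert a A) = rooted_cycle_sum x A a 0"
  unfolding cycle_sum_def rooted_cycle_sum_def
proof (rule sum.cong)
  fix \<sigma> :: "'a \<Rightarrow> 'a"
  have "(\<Prod>C\<in>orbit \<sigma> ` insert a A. x (card C)) = (\<Prod>C\<in>insert (orbit \<sigma> a) (orbit \<sigma> ` A - {orbit \<sigma> a}). x (card C))"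
    by (rule prod.cong) auto
  then show "(\<Prod>C\<in>orbit \<sigma> ` insert a A. x (card C)) =
      x (card (orbit \<sigma> a) + 0) * (\<Prod>C\<in>orbit \<sigma> ` A - {orbit \<sigma> a}. x (card C))"
    using assms by (subst (asm) prod.insert) auto
qed simp

text \<open>
  Either the root is a fixed point, and then its cycle is complete and contributes
  \<open>x (Suc s)\<close>, or it precedes some \<open>b\<close>; contracting it into \<open>b\<close> makes \<open>b\<close> the new root, with
  one more contracted point.
\<close>

lemma rooted_cycle_sum_rec:
  assumes fin: "finite A" and a: "a \<notin> A"
  shows "rooted_cycle_sum x A a s =
    x (Suc s) * cycle_sum x A + (\<Sum>b\<in>A. rooted_cycle_sum x (A - {b}) b (Suc s))"
proof -
  define f where "f \<sigma> = x (card (orbit \<sigma> a) + s) * (\<Prod>C\<in>orbit \<sigma> ` A - {orbit \<sigma> a}. x (card C))"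
    for \<sigma>
  have fixed: "f (Transposition.transpose a a \<circ> \<tau>) = x (Suc s) * (\<Prod>C\<in>orbit \<tau> ` A. x (card C))"
    if \<tau>: "\<tau> permutes A" for \<tau>
  proof -
    have orb: "orbit \<tau> a = {a}"
      using permutes_not_in[OF \<tau> a] by (simp add: orbit_eq_singleton_iff)
    have "orbit \<tau> ` A - {{a}} = orbit \<tau> ` A"
      using permutes_orbit_subset[OF \<tau>] a by fastforce
    then show ?thesis
      by (simp add: f_def orb)
  qed
  have moved: "f (Transposition.transpose a b \<circ> \<tau>) =
      x (card (orbit \<tau> b) + Suc s) * (\<Prod>C\<in>orbit \<tau> ` (A - {b}) - {orbit \<tau> b}. x (card C))"
    if \<tau>: "\<tau> permutes A" and b: "b \<in> A" for \<tau> b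
  proof -
    have sub: "orbit \<tau> b \<subseteq> A"
      by (rule permutes_orbit_subset[OF \<tau> b])
    then have "card (insert a (orbit \<tau> b)) = Suc (card (orbit \<tau> b))"
      using a fin by (meson card_insert_disjoint finite_subset subsetD)
    moreover have "orbit \<tau> ` (A - {b}) - {orbit \<tau> b} = orbit \<tau> ` A - {orbit \<tau> b}"
      by auto
    ultimately show ?thesis
      unfolding f_def other_orbits_transpose_comp[OF \<tau> fin a b]
      by (simp add: orbit_transpose_comp_new[OF \<tau> fin a b] del: o_apply)
  qed
  have "rooted_cycle_sum x A a s =
      (\<Sum>b\<in>insert a A. \<Sum>\<tau> | \<tau> permutes A. f (Transposition.transpose a b \<circ> \<tau>))"
    unfolding rooted_cycle_sum_def f_def by (rule sum_over_permutations_insert[OF fin a])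
  also have "\<dots> = (\<Sum>\<tau> | \<tau> permutes A. f (Transposition.transpose a a \<circ> \<tau>)) +
      (\<Sum>b\<in>A. \<Sum>\<tau> | \<tau> permutes A. f (Transposition.transpose a b \<circ> \<tau>))"
    using fin a by (rule sum.insert)
  also have "(\<Sum>\<tau> | \<tau> permutes A. f (Transposition.transpose a a \<circ> \<tau>)) = x (Suc s) * cycle_sum x A"
    unfolding cycle_sum_def sum_distrib_left by (rule sum.cong) (use fixed in auto)
  also have "(\<Sum>b\<in>A. \<Sum>\<tau> | \<tau> permutes A. f (Transposition.transpose a b \<circ> \<tau>)) =
      (\<Sum>b\<in>A. rooted_cycle_sum x (A - {b}) b (Suc s))"
  proof (rule sum.cong[OF refl])
    fix b assume b: "b \<in> A"
    then show "(\<Sum>\<tau> | \<tau> permutes A. f (Transposition.transpose a b \<circ> \<tau>)) = rooted_cycle_sum x (A - {b}) b (Suc s)"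
      unfolding rooted_cycle_sum_def insert_Diff[OF b] by (intro sum.cong) (use moved in auto)
  qed
  finally show ?thesis .
qed

text \<open>
  The assumption on \<open>Z\<close> is the Newton-type recurrence with indices shifted by one. The rooted and
  unrooted sums are evaluated together: the rooted sum over \<open>Suc m\<close> points besides the root
  needs the unrooted one of that size (when the root is fixed) and rooted ones of size \<open>m\<close>,
  while the unrooted sum over \<open>Suc m\<close> points is a rooted one of size \<open>m\<close>.
\<close>

lemma cycle_sum_eq_fact_mult:
  fixes x Z :: "nat \<Rightarrow> 'b::{comm_semiring_1, semiring_char_0}"
  assumes Z0: "Z 0 = 1"
    and Z_rec: "\<And>m. of_nat (Suc m) * Z (Suc m) = (\<Sum>j\<le>m. x (Suc j) * Z (m - j))"
    and "finite A"
  shows "cycle_sum x A = fact (card A) * Z (card A)"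
proof -
  have "(finite A \<and> card A = m \<longrightarrow> cycle_sum x A = fact m * Z m) \<and>
     (finite A \<and> card A = m \<and> a \<notin> A \<longrightarrow>
       rooted_cycle_sum x A a s = fact m * (\<Sum>j\<le>m. x (Suc s + j) * Z (m - j)))" for A :: "'a set" and a s m
  proof (induction m arbitrary: A a s)
    case 0
    have *: "cycle_sum x ({} :: 'a set) = 1"
      by (simp add: cycle_sum_def)
    show ?case
      using rooted_cycle_sum_rec[of "{}" a x s] by (auto simp: Z0 *)
  next
    case (Suc m)
    have cyc: "cycle_sum x A = fact (Suc m) * Z (Suc m)" if A: "finite A" "card A = Suc m" for A :: "'a set"
    proof -
      obtain b B where B: "A = insert b B" "b \<notin> B" "card B = m" "finite B"
        using A by (auto simp: card_Suc_eq_finite)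
      have "cycle_sum x A = rooted_cycle_sum x B b 0"
        unfolding B(1) by (rule cycle_sum_insert[OF B(4)])
      also have "\<dots> = fact m * (\<Sum>j\<le>m. x (Suc j) * Z (m - j))"
        using Suc.IH[of B b 0] B by simp
      also have "\<dots> = fact (Suc m) * Z (Suc m)"
        unfolding Z_rec[symmetric] by (simp add: algebra_simps)
      finally show ?thesis .
    qed
    have "rooted_cycle_sum x A a s = fact (Suc m) * (\<Sum>j\<le>Suc m. x (Suc s + j) * Z (Suc m - j))"
      if A: "finite A" "card A = Suc m" "a \<notin> A"
    proof -
      have "(\<Sum>b\<in>A. rooted_cycle_sum x (A - {b}) b (Suc s)) =
          (\<Sum>b\<in>A. fact m * (\<Sum>j\<le>m. x (Suc (Suc s) + j) * Z (m - j)))"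
        by (rule sum.cong[OF refl]) (use Suc.IH A in auto)
      also have "\<dots> = fact (Suc m) * (\<Sum>j\<le>m. x (Suc (Suc s) + j) * Z (m - j))"
        by (simp add: A algebra_simps)
      finally have "rooted_cycle_sum x A a s =
        x (Suc s) * (fact (Suc m) * Z (Suc m)) + fact (Suc m) * (\<Sum>j\<le>m. x (Suc (Suc s) + j) * Z (m - j))"
        by (simp only: rooted_cycle_sum_rec[OF A(1,3)] cyc[OF A(1,2)])
      then show ?thesis
        by (simp add: sum.atMost_Suc_shift algebra_simps del: sum.atMost_Suc fact_Suc)
    qed
    with cyc show ?case
      by blast
  qed
  then show ?thesis
    using \<open>finite A\<close> by blast
qed

lemma prod_power_cycle_count:
  assumes \<sigma>: "\<sigma> permutes {1..N}"
  shows "(\<Prod>i=1..N. x i ^ cycle_count N \<sigma> i) = (\<Prod>C\<in>orbit \<sigma> ` {1..N}. x (card C) :: real)"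
proof -
  have card_in: "card ` orbit \<sigma> ` {1..N} \<subseteq> {1..N}"
  proof clarify
    fix m assume m: "m \<in> {1..N}"
    have sub: "orbit \<sigma> m \<subseteq> {1..N}"
      by (rule permutes_orbit_subset[OF \<sigma> m])
    then have "card (orbit \<sigma> m) \<le> N"
      using card_mono[OF _ sub] by simp
    moreover have "card (orbit \<sigma> m) > 0"
      using sub by (simp add: card_gt_0_iff orbit_nonempty finite_subset)
    ultimately show "card (orbit \<sigma> m) \<in> {1..N}"
      by simp
  qed
  have "(\<Prod>C\<in>orbit \<sigma> ` {1..N}. x (card C)) =
      (\<Prod>i=1..N. \<Prod>C\<in>{C \<in> orbit \<sigma> ` {1..N}. card C = i}. x (card C))"
    by (rule prod.group[symmetric]) (use card_in in auto)
  also have "\<dots> = (\<Prod>i=1..N. x i ^ cycle_count N \<sigma> i)"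
  proof (rule prod.cong[OF refl])
    fix i
    have "{C \<in> orbit \<sigma> ` {1..N}. card C = i} = {C. (\<exists>m\<in>{1..N}. C = orbit \<sigma> m) \<and> card C = i}"
      by auto
    then show "(\<Prod>C\<in>{C \<in> orbit \<sigma> ` {1..N}. card C = i}. x (card C)) = x i ^ cycle_count N \<sigma> i"
      unfolding cycle_count_def by simp
  qed
  finally show ?thesis ..
qed

text \<open>
  Uniqueness of the solution of the recurrence: a sequence is recognised as the sequence of
  cycle indices without exhibiting any permutation.
\<close>

lemma cycle_index_eqI:
  fixes x Z :: "nat \<Rightarrow> real"
  assumes "Z 0 = 1"
    and "\<And>m. real (Suc m) * Z (Suc m) = (\<Sum>j\<le>m. x (Suc j) * Z (m - j))"
  shows "cycle_index N x = Z N"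
proof -
  have "cycle_index N x = 1 / fact N * cycle_sum x {1..N}"
    unfolding cycle_index_def cycle_sum_def
    by (intro arg_cong2[where f = "(*)"] sum.cong prod_power_cycle_count) auto
  also have "cycle_sum x {1..N} = fact N * Z N"
    using cycle_sum_eq_fact_mult[of Z x "{1..N}"] assms by simp
  finally show ?thesis
    by simp
qed

section \<open>Products of linear factors\<close>

text \<open>
  The logarithmic derivative of \<open>1 - u * X\<close> is \<open>- u / (1 - u * X)\<close>, a geometric series with
  coefficients \<open>- u ^ Suc r\<close>; those of the factors add up. Multiplying through by the product
  avoids division of power series.
\<close>

lemma fps_deriv_prod_linear:
  fixes u :: "'a \<Rightarrow> 'b::idom"
  assumes "finite J"
  shows "fps_deriv (\<Prod>j\<in>J. 1 - fps_const (u j) * fps_X) =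
    (\<Prod>j\<in>J. 1 - fps_const (u j) * fps_X) * Abs_fps (\<lambda>r. - (\<Sum>j\<in>J. u j ^ Suc r))"
  using assms
proof induction
  case empty
  then show ?case
    by (simp flip: fps_zero_def)
next
  case (insert i J)
  define L where "L = 1 - fps_const (u i) * fps_X"
  define P where "P = (\<Prod>j\<in>J. 1 - fps_const (u j) * fps_X)"
  define S where "S = Abs_fps (\<lambda>r. - (\<Sum>j\<in>J. u j ^ Suc r))"
  define G where "G = Abs_fps (\<lambda>r. - (u i ^ Suc r))"
  have IH: "fps_deriv P = P * S"
    using insert.IH by (simp add: P_def S_def)
  have LG: "L * G = fps_deriv L"
  proof (rule fps_ext)
    fix r show "fps_nth (L * G) r = fps_nth (fps_deriv L) r"
      by (cases r) (simp_all add: L_def G_def left_diff_distrib mult.assoc)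
  qed
  have "Abs_fps (\<lambda>r. - (\<Sum>j\<in>insert i J. u j ^ Suc r)) = S + G"
    using insert.hyps by (intro fps_ext) (simp add: S_def G_def)
  moreover have "fps_deriv (L * P) = L * P * (S + G)"
    by (simp add: IH LG[symmetric] algebra_simps)
  ultimately show ?case
    using insert.hyps by (simp add: L_def P_def)
qed

text \<open>
  This is the identity \<open>exp (\<Sum>r\<ge>1. x r * t ^ r / r) = (\<Sum>k. Z k * t ^ k)\<close> for those \<open>x\<close> for
  which the left-hand side is a product of linear factors.
\<close>

lemma coeff_prod_linear_eq_cycle_index:
  fixes u :: "'a \<Rightarrow> real"
  assumes fin: "finite J" and x: "\<And>r. r \<ge> 1 \<Longrightarrow> x r = - (\<Sum>j\<in>J. u j ^ r)"
  shows "coeff (\<Prod>j\<in>J. [:1, - u j:]) k = cycle_index k x"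
proof -
  define P where "P = (\<Prod>j\<in>J. [:1, - u j:])"
  have fps_P: "fps_of_poly P = (\<Prod>j\<in>J. 1 - fps_const (u j) * fps_X)"
    unfolding P_def fps_of_poly_prod fps_of_poly_linear' by (simp flip: fps_const_neg)
  have "coeff P 0 = 1"
    unfolding P_def by (simp add: poly_prod flip: poly_0_coeff_0)
  moreover have "real (Suc m) * coeff P (Suc m) = (\<Sum>j\<le>m. x (Suc j) * coeff P (m - j))" for m
  proof -
    have "real (Suc m) * coeff P (Suc m) = fps_nth (fps_deriv (fps_of_poly P)) m"
      by simp
    also have "\<dots> = fps_nth (Abs_fps (\<lambda>r. - (\<Sum>j\<in>J. u j ^ Suc r)) * fps_of_poly P) m"
      unfolding fps_P fps_deriv_prod_linear[OF fin] by (simp add: mult.commute)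
    also have "\<dots> = (\<Sum>j\<le>m. x (Suc j) * coeff P (m - j))"
      by (simp add: fps_mult_nth x atLeast0AtMost)
    finally show ?thesis .
  qed
  ultimately show ?thesis
    unfolding P_def by (intro cycle_index_eqI[symmetric])
qed

lemma higher_deriv_poly_shift:
  fixes p :: "real poly"
  shows "(deriv ^^ k) (\<lambda>x. poly p (x - \<xi>)) \<xi> / fact k = coeff p k"
proof -
  have "(deriv ^^ k) (\<lambda>x. poly p (x - \<xi>)) = (\<lambda>x. poly ((pderiv ^^ k) p) (x - \<xi>))"
  proof (induction k)
    case (Suc k)
    have "deriv (\<lambda>x. poly q (x - \<xi>)) x = poly (pderiv q) (x - \<xi>)" for q x
      by (rule DERIV_imp_deriv) (auto intro!: derivative_eq_intros)
    then show ?case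
      by (simp add: Suc fun_eq_iff)
  qed simp
  then show ?thesis
    by (simp add: poly_0_coeff_0 coeff_higher_pderiv flip: pochhammer_fact)
qed


section \<open>Lagrange fundamental polynomials expanded at a node\<close>

text \<open>At the node itself each factor is \<open>1 - t / d\<close>, with no constant to split off.\<close>

lemma lagrange_coeff_self:
  fixes node :: "nat \<Rightarrow> real"
  assumes inj: "inj_on node {0..n}"
    and x: "\<And>r. r \<ge> 1 \<Longrightarrow> x r = - (\<Sum>j=1..n. (1 / (node j - node 0)) ^ r)"
  shows "lagrange_coeff node n (node 0) 0 k = cycle_index k x"
proof -
  define P where "P = (\<Prod>j=1..n. [:1, - (1 / (node j - node 0)):])"
  have nz: "node j - node 0 \<noteq> 0" if "j \<in> {1..n}" for j
    using inj_onD[OF inj, of j 0] that by auto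
  have "lagrange_fundamental node n 0 t = poly P (t - node 0)" for t
  proof -
    have "{0..n} - {0} = {1..n}"
      by auto
    moreover have "(t - node j) / (node 0 - node j) = poly [:1, - (1 / (node j - node 0)):] (t - node 0)"
      if "j \<in> {1..n}" for j
      using nz[OF that] by (simp add: field_simps)
    ultimately show ?thesis
      unfolding lagrange_fundamental_def P_def poly_prod by simp
  qed
  then have "lagrange_fundamental node n 0 = (\<lambda>t. poly P (t - node 0))"
    by auto
  then show ?thesis
    unfolding lagrange_coeff_def P_def
    by (simp only: higher_deriv_poly_shift)
       (rule coeff_prod_linear_eq_cycle_index[OF _ x], auto)
qed

text \<open>
  The factor \<open>t / (node i - node 0)\<close> lowers the degree of the cycle index by one, and each of
  the other factors is normalised to constant term \<open>1\<close>.
\<close>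

lemma lagrange_coeff_other:
  fixes node :: "nat \<Rightarrow> real"
  assumes inj: "inj_on node {0..n}" and i: "i \<in> {1..n}" and k: "k \<ge> 1"
    and x: "\<And>r. r \<ge> 1 \<Longrightarrow> x r = - (\<Sum>j\<in>{1..n} - {i}. (1 / (node j - node 0)) ^ r)"
  shows "lagrange_coeff node n (node 0) i k =
    1 / (node i - node 0) * (\<Prod>j\<in>{1..n} - {i}. (node j - node 0) / (node j - node i)) *
      cycle_index (k - 1) x"
proof -
  define J where "J = {1..n} - {i}"
  define P where "P = (\<Prod>j\<in>J. [:1, - (1 / (node j - node 0)):])"
  define K where "K = 1 / (node i - node 0) * (\<Prod>j\<in>J. (node j - node 0) / (node j - node i))"
  have "lagrange_fundamental node n i t = poly (smult K (pCons 0 P)) (t - node 0)" for t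
  proof -
    have "{0..n} - {i} = insert 0 J"
      using i by (auto simp: J_def)
    then have "lagrange_fundamental node n i t =
        (t - node 0) / (node i - node 0) * (\<Prod>j\<in>J. (t - node j) / (node i - node j))"
      unfolding lagrange_fundamental_def by (simp add: J_def)
    also have "(\<Prod>j\<in>J. (t - node j) / (node i - node j)) =
        (\<Prod>j\<in>J. (node j - node 0) / (node j - node i) *
          poly [:1, - (1 / (node j - node 0)):] (t - node 0))"
    proof (rule prod.cong[OF refl])
      fix j assume "j \<in> J"
      then have "node j - node 0 \<noteq> 0" "node j - node i \<noteq> 0"
        using inj_onD[OF inj, of j 0] inj_onD[OF inj, of j i] i by (auto simp: J_def)
      then show "(t - node j) / (node i - node j) = (node j - node 0) / (node j - node i) *
          poly [:1, - (1 / (node j - node 0)):] (t - node 0)"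
        by (simp add: divide_simps) (simp add: algebra_simps)
    qed
    also have "\<dots> = (\<Prod>j\<in>J. (node j - node 0) / (node j - node i)) * poly P (t - node 0)"
      by (simp only: P_def poly_prod prod.distrib)
    finally show ?thesis
      by (simp add: K_def)
  qed
  then have "lagrange_fundamental node n i = (\<lambda>t. poly (smult K (pCons 0 P)) (t - node 0))"
    by auto
  then have "lagrange_coeff node n (node 0) i k = coeff (smult K (pCons 0 P)) k"
    unfolding lagrange_coeff_def by (simp only: higher_deriv_poly_shift)
  also have "\<dots> = K * coeff P (k - 1)"
    using k by (simp add: coeff_pCons split: nat.split)
  also have "coeff P (k - 1) = cycle_index (k - 1) x"
    unfolding P_def using x by (intro coeff_prod_linear_eq_cycle_index) (auto simp: J_def)
  finally show ?thesis
    by (simp add: K_def J_def)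
qed

section \<open>Equidistant nodes\<close>

text \<open>
  The index of the node at offset \<open>c * h\<close>: the nodes alternate between the two sides as long as
  \<open>\<bar>c\<bar> \<le> \<nu>\<close>, and the remaining ones lie to the left.
\<close>

definition node_index :: "nat \<Rightarrow> int \<Rightarrow> nat" where
  "node_index \<nu> c =
     (if c > 0 then 2 * nat c - 1 else if - c \<le> int \<nu> then 2 * nat (- c) else \<nu> + nat (- c))"

lemma node_index_0 [simp]: "node_index \<nu> 0 = 0"
  by (simp add: node_index_def)

lemma bij_betw_node_index:
  assumes "2 * \<nu> \<le> n"
  shows "bij_betw (node_index \<nu>) {- int (n - \<nu>)..int \<nu>} {0..n}"
proof -
  let ?M = "{- int (n - \<nu>)..int \<nu>}"
  have inj: "inj_on (node_index \<nu>) ?M"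
  proof (rule inj_onI)
    fix c d assume "c \<in> ?M" "d \<in> ?M" and eq: "node_index \<nu> c = node_index \<nu> d"
    then have "c \<le> int \<nu>" "d \<le> int \<nu>"
      by auto
    \<comment> \<open>Over the integers, positive offsets get odd values, small negative ones even values, and
      the remaining ones exceed \<open>2 * \<nu>\<close>.\<close>
    moreover have int_index: "int (node_index \<nu> m) =
        (if m > 0 then 2 * m - 1 else if - m \<le> int \<nu> then - 2 * m else int \<nu> - m)" for m
      by (simp add: node_index_def)
    ultimately show "c = d"
      using arg_cong[OF eq, of int] unfolding int_index by (auto split: if_splits; presburger)
  qed
  have "node_index \<nu> ` ?M \<subseteq> {0..n}"
    using assms by (auto simp: node_index_def)
  moreover have "card (node_index \<nu> ` ?M) = card {0..n}"
    unfolding card_image[OF inj] using assms by simp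
  ultimately have "node_index \<nu> ` ?M = {0..n}"
    by (intro card_subset_eq) auto
  with inj show ?thesis
    by (simp add: bij_betw_def)
qed

lemma int_interval_minus_point:
  fixes c :: int
  assumes "lo \<le> c" "c \<le> hi"
  shows "{lo..hi} - {c} =
    (\<lambda>j. c + int j) ` {1..nat (hi - c)} \<union> (\<lambda>j. c - int j) ` {1..nat (c - lo)}"
proof (intro equalityI subsetI)
  fix m assume m: "m \<in> {lo..hi} - {c}"
  show "m \<in> (\<lambda>j. c + int j) ` {1..nat (hi - c)} \<union> (\<lambda>j. c - int j) ` {1..nat (c - lo)}"
  proof (cases "m > c")
    case True
    then show ?thesis
      using m by (intro UnI1 image_eqI[of _ _ "nat (m - c)"]) auto
  next
    case False
    then show ?thesis
      using m by (intro UnI2 image_eqI[of _ _ "nat (c - m)"]) auto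
  qed
qed (use assms in auto)

lemma prod_int_interval_minus_point:
  fixes c :: int
  assumes "lo \<le> c" "c \<le> hi"
  shows "(\<Prod>m\<in>{lo..hi} - {c}. real_of_int (m - c)) =
    (-1) ^ nat (c - lo) * fact (nat (c - lo)) * fact (nat (hi - c))"
proof -
  have "(\<Prod>m\<in>{lo..hi} - {c}. real_of_int (m - c)) =
      (\<Prod>j=1..nat (hi - c). real j) * (\<Prod>j=1..nat (c - lo). - real j)"
    unfolding int_interval_minus_point[OF assms]
    by (subst prod.union_disjoint) (auto simp: prod.reindex inj_on_def)
  also have "(\<Prod>j=1..nat (c - lo). - real j) = (-1) ^ nat (c - lo) * fact (nat (c - lo))"
    by (simp add: fact_prod prod_uminus)
  finally show ?thesis
    by (simp add: fact_prod)
qed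

text \<open>
  Numerator and denominator are each a full product over an interval with one point removed,
  divided by a single factor: \<open>c\<close> in the numerator and \<open>0 - c\<close> in the denominator. These two
  cancel up to the leading minus sign.
\<close>

lemma prod_equidistant_quotients:
  fixes c :: int
  assumes c: "c \<in> {- int q..int p}" "c \<noteq> 0"
  shows "(\<Prod>m\<in>{- int q..int p} - {0} - {c}. real_of_int m / real_of_int (m - c)) =
    - ((-1) ^ nat \<bar>c\<bar>) * fact p * fact q / (fact (nat (int p - c)) * fact (nat (int q + c)))"
proof -
  let ?M = "{- int q..int p}"
  have "(\<Prod>m\<in>?M - {0}. real_of_int m) = real_of_int c * (\<Prod>m\<in>?M - {0} - {c}. real_of_int m)"
    using c by (intro prod.remove) auto
  moreover have "(\<Prod>m\<in>?M - {0}. real_of_int m) = (-1) ^ q * fact q * fact p"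
    using prod_int_interval_minus_point[of "- int q" 0 "int p"] by simp
  ultimately have num: "(\<Prod>m\<in>?M - {0} - {c}. real_of_int m) = (-1) ^ q * fact q * fact p / c"
    using c by (simp add: field_simps)
  have "(\<Prod>m\<in>?M - {c}. real_of_int (m - c)) =
      real_of_int (0 - c) * (\<Prod>m\<in>?M - {c} - {0}. real_of_int (m - c))"
    using c by (intro prod.remove) auto
  moreover have "?M - {c} - {0} = ?M - {0} - {c}"
    by auto
  moreover have "(\<Prod>m\<in>?M - {c}. real_of_int (m - c)) =
      (-1) ^ nat (c + int q) * fact (nat (int q + c)) * fact (nat (int p - c))"
    using prod_int_interval_minus_point[of "- int q" c "int p"] c by (simp add: add.commute)
  ultimately have den: "(\<Prod>m\<in>?M - {0} - {c}. real_of_int (m - c)) =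
      - ((-1) ^ nat (c + int q) * fact (nat (int q + c)) * fact (nat (int p - c)) / c)"
    using c by (simp add: field_simps)
  have "(-1) ^ q = (-1) ^ nat \<bar>c\<bar> * (-1 :: real) ^ nat (c + int q)"
  proof -
    have "even (nat \<bar>c\<bar> + nat (c + int q)) \<longleftrightarrow> even q"
      using c(1) by (auto simp: even_nat_iff)
    then show ?thesis
      unfolding minus_one_power_iff even_add by simp blast
  qed
  then show ?thesis
    unfolding prod_dividef num den using c by (simp add: field_simps)
qed

theorem theorem3p1:
  fixes a b \<xi> h :: real and n \<nu> k :: nat and node \<eta> :: "nat \<Rightarrow> real"
  assumes "a < \<xi>" and "\<xi> < b" and "b - \<xi> < \<xi> - a"
    and "n \<ge> 1"
    and "(a - \<xi> + real n * (b - \<xi>)) / (b - a) < real \<nu>" and "real \<nu> \<le> real n / 2"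
    and h: "h = (b - \<xi>) / (real \<nu> + 1)"
    and node_0: "node 0 = \<xi>"
    and node_odd: "\<And>j. 1 \<le> j \<Longrightarrow> j \<le> \<nu> \<Longrightarrow> node (2 * j - 1) = \<xi> + real j * h"
    and node_even: "\<And>j. 1 \<le> j \<Longrightarrow> j \<le> \<nu> \<Longrightarrow> node (2 * j) = \<xi> - real j * h"
    and node_tail: "\<And>j. \<nu> + 1 \<le> j \<Longrightarrow> j \<le> n - \<nu> \<Longrightarrow> node (\<nu> + j) = \<xi> - real j * h"
    and eta: "\<And>r. r \<ge> 1 \<Longrightarrow>
      \<eta> r = (-1) / h ^ r * ((\<Sum>j=1..\<nu>. 1 / real j ^ r) + (\<Sum>j=1..n-\<nu>. 1 / (- real j) ^ r))"
    and "k \<ge> 1"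
  shows "lagrange_coeff node n \<xi> 0 k = cycle_index k \<eta>
    \<and> (\<forall>i\<in>{1..\<nu>}.
        lagrange_coeff node n \<xi> (2 * i - 1) k =
          (-1) ^ (i - 1) * fact \<nu> * fact (n - \<nu>) / (h * real i * fact (\<nu> - i) * fact (n - \<nu> + i))
          * cycle_index (k - 1) (\<lambda>r. \<eta> r + 1 / (h ^ r * real i ^ r))
      \<and> lagrange_coeff node n \<xi> (2 * i) k =
          (-1) ^ i * fact \<nu> * fact (n - \<nu>) / (h * real i * fact (\<nu> + i) * fact (n - \<nu> - i))
          * cycle_index (k - 1) (\<lambda>r. \<eta> r + 1 / (h ^ r * (- real i) ^ r)))
    \<and> (\<forall>i\<in>{\<nu> + 1..n - \<nu>}.
        lagrange_coeff node n \<xi> (\<nu> + i) k =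
          (-1) ^ i * fact \<nu> * fact (n - \<nu>) / (h * real i * fact (\<nu> + i) * fact (n - \<nu> - i))
          * cycle_index (k - 1) (\<lambda>r. \<eta> r + 1 / (h ^ r * (- real i) ^ r)))"
proof -
  have h_pos: "h > 0"
    using assms(2) by (simp add: h)
  \<comment> \<open>Hence the alternating part of the numbering fits into \<open>{0..n}\<close>.\<close>
  have two_\<nu>: "2 * \<nu> \<le> n"
    using assms(6) by linarith
  define M where "M = {- int (n - \<nu>)..int \<nu>}"
  define g where "g = node_index \<nu>"
  have fin_M: "finite M" and zero_M: "0 \<in> M" and g0: "g 0 = 0"
    by (auto simp: M_def g_def)
  have bij: "bij_betw g M {0..n}"
    unfolding g_def M_def by (rule bij_betw_node_index[OF two_\<nu>])
  have node_g: "node (g c) = \<xi> + real_of_int c * h" if c: "c \<in> M" for c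
  proof -
    consider "c > 0" "c \<le> int \<nu>" | "c = 0" | "c < 0" "- c \<le> int \<nu>"
      | "c < 0" "- c > int \<nu>" "- c \<le> int (n - \<nu>)"
      using c unfolding M_def atLeastAtMost_iff by linarith
    then show ?thesis
    proof cases
      case 1
      then show ?thesis
        using node_odd[of "nat c"] by (auto simp: g_def node_index_def)
    next
      case 2
      then show ?thesis
        by (simp add: g0 node_0)
    next
      case 3
      then show ?thesis
        using node_even[of "nat (- c)"] by (auto simp: g_def node_index_def)
    next
      case 4
      then show ?thesis
        using node_tail[of "nat (- c)"] by (auto simp: g_def node_index_def)
    qed
  qed
  have inj: "inj_on node {0..n}"
    unfolding bij_betw_imp_surj_on[OF bij, symmetric]
    using node_g h_pos by (auto simp: inj_on_def)
  have bij_0: "bij_betw g (M - {0}) {1..n}"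
    using bij_betw_DiffI[OF bij, of "{0}" "{0}"] zero_M g0 by (auto simp: atLeast0AtMost atLeast1_atMost_eq_remove0)
  \<comment> \<open>Thus \<open>\<eta>\<close> is the negative power sum of the reciprocal offsets of all nodes but \<open>\<xi>\<close>.\<close>
  have eta_M: "\<eta> r = - (\<Sum>m\<in>M - {0}. (1 / (real_of_int m * h)) ^ r)" if "r \<ge> 1" for r
  proof -
    have "(\<Sum>m\<in>M - {0}. (1 / (real_of_int m * h)) ^ r) =
        (\<Sum>j=1..\<nu>. (1 / (real j * h)) ^ r) + (\<Sum>j=1..n-\<nu>. (1 / (- real j * h)) ^ r)"
      unfolding M_def
      by (subst int_interval_minus_point, simp, simp, subst sum.union_disjoint)
         (auto simp: sum.reindex inj_on_def)
    also have "\<dots> = 1 / h ^ r * ((\<Sum>j=1..\<nu>. 1 / real j ^ r) + (\<Sum>j=1..n-\<nu>. 1 / (- real j) ^ r))"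
    proof -
      have "(1 / (y * h)) ^ r = 1 / h ^ r * (1 / y ^ r)" for y
        by (simp add: power_divide power_mult_distrib)
      then show ?thesis
        by (simp only: distrib_left sum_distrib_left)
    qed
    finally show ?thesis
      unfolding eta[OF that] by simp
  qed
  \<comment> \<open>The formula for both sides of \<open>\<xi>\<close> at once: the factorial that grows with the distance
    is the one belonging to the opposite side.\<close>
  have offset: "lagrange_coeff node n \<xi> (g c) k =
      - ((-1) ^ nat \<bar>c\<bar>) * fact \<nu> * fact (n - \<nu>) /
          (h * real_of_int c * fact (nat (int \<nu> - c)) * fact (nat (int (n - \<nu>) + c)))
        * cycle_index (k - 1) (\<lambda>r. \<eta> r + 1 / (h ^ r * real_of_int c ^ r))"
    if c: "c \<in> M" "c \<noteq> 0" for c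
  proof -
    have gc: "g c \<in> {1..n}"
      using bij_betwE[OF bij_0] c by auto
    have bij_c: "bij_betw g (M - {0} - {c}) ({1..n} - {g c})"
      using bij_betw_DiffI[OF bij_0, of "{c}" "{g c}"] c gc by auto
    have "lagrange_coeff node n (node 0) (g c) k =
      1 / (node (g c) - node 0) * (\<Prod>j\<in>{1..n} - {g c}. (node j - node 0) / (node j - node (g c))) *
      cycle_index (k - 1) (\<lambda>r. \<eta> r + 1 / (h ^ r * real_of_int c ^ r))"
    proof (rule lagrange_coeff_other[OF inj gc \<open>k \<ge> 1\<close>])
      fix r :: nat assume r: "r \<ge> 1"
      have "(\<Sum>j\<in>{1..n} - {g c}. (1 / (node j - node 0)) ^ r) =
          (\<Sum>m\<in>M - {0} - {c}. (1 / (node (g m) - node 0)) ^ r)"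
        by (rule sum.reindex_bij_betw[OF bij_c, symmetric])
      also have "\<dots> = (\<Sum>m\<in>M - {0} - {c}. (1 / (real_of_int m * h)) ^ r)"
        by (rule sum.cong) (auto simp: node_g node_0)
      also have "\<dots> = (\<Sum>m\<in>M - {0}. (1 / (real_of_int m * h)) ^ r) - (1 / (real_of_int c * h)) ^ r"
        using c fin_M by (simp add: sum_diff1)
      finally show "\<eta> r + 1 / (h ^ r * real_of_int c ^ r) =
          - (\<Sum>j\<in>{1..n} - {g c}. (1 / (node j - node 0)) ^ r)"
        by (simp add: eta_M[OF r] power_divide power_mult_distrib mult.commute)
    qed
    also have "(\<Prod>j\<in>{1..n} - {g c}. (node j - node 0) / (node j - node (g c))) =
        (\<Prod>m\<in>M - {0} - {c}. (node (g m) - node 0) / (node (g m) - node (g c)))"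
      by (rule prod.reindex_bij_betw[OF bij_c, symmetric])
    also have "\<dots> = (\<Prod>m\<in>M - {0} - {c}. real_of_int m / real_of_int (m - c))"
    proof (rule prod.cong[OF refl])
      fix m assume "m \<in> M - {0} - {c}"
      moreover from this have "real_of_int m * h - real_of_int c * h \<noteq> 0"
        using h_pos by simp
      ultimately show "(node (g m) - node 0) / (node (g m) - node (g c)) =
          real_of_int m / real_of_int (m - c)"
        using c h_pos by (simp add: node_g node_0 flip: left_diff_distrib)
    qed
    also have "\<dots> = - ((-1) ^ nat \<bar>c\<bar>) * fact \<nu> * fact (n - \<nu>) /
        (fact (nat (int \<nu> - c)) * fact (nat (int (n - \<nu>) + c)))"
      unfolding M_def using c by (intro prod_equidistant_quotients) (auto simp: M_def)
    finally show ?thesis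
      using c by (simp add: node_g node_0 mult_ac)
  qed
  have centre: "lagrange_coeff node n \<xi> 0 k = cycle_index k \<eta>"
  proof -
    have "\<eta> r = - (\<Sum>j=1..n. (1 / (node j - node 0)) ^ r)" if r: "r \<ge> 1" for r
    proof -
      have "(\<Sum>j=1..n. (1 / (node j - node 0)) ^ r) =
          (\<Sum>m\<in>M - {0}. (1 / (node (g m) - node 0)) ^ r)"
        by (rule sum.reindex_bij_betw[OF bij_0, symmetric])
      also have "\<dots> = (\<Sum>m\<in>M - {0}. (1 / (real_of_int m * h)) ^ r)"
        by (rule sum.cong) (auto simp: node_g node_0)
      finally show ?thesis
        by (simp add: eta_M[OF r])
    qed
    then show ?thesis
      using lagrange_coeff_self[OF inj, of \<eta> k] node_0 by simp
  qed
  have above: "lagrange_coeff node n \<xi> (2 * i - 1) k =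
          (-1) ^ (i - 1) * fact \<nu> * fact (n - \<nu>) / (h * real i * fact (\<nu> - i) * fact (n - \<nu> + i))
          * cycle_index (k - 1) (\<lambda>r. \<eta> r + 1 / (h ^ r * real i ^ r))" if i: "i \<in> {1..\<nu>}" for i
  proof -
    have "int i \<in> M" "int i \<noteq> 0" "g (int i) = 2 * i - 1"
      using i by (auto simp: M_def g_def node_index_def)
    moreover have "nat (int \<nu> - int i) = \<nu> - i" "nat (int (n - \<nu>) + int i) = n - \<nu> + i"
      using i by auto
    moreover have "- ((-1) ^ i) = (-1 :: real) ^ (i - 1)"
      using i by (cases i) auto
    ultimately show ?thesis
      using offset[of "int i"] by simp
  qed
  have below: "lagrange_coeff node n \<xi> j k =
          (-1) ^ i * fact \<nu> * fact (n - \<nu>) / (h * real i * fact (\<nu> + i) * fact (n - \<nu> - i))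
          * cycle_index (k - 1) (\<lambda>r. \<eta> r + 1 / (h ^ r * (- real i) ^ r))"
    if i: "i \<in> {1..n - \<nu>}" and j: "j = g (- int i)" for i j
  proof -
    have "- int i \<in> M" "- int i \<noteq> 0"
      using i by (auto simp: M_def)
    moreover have "nat (int \<nu> - - int i) = \<nu> + i" "nat (int (n - \<nu>) + - int i) = n - \<nu> - i"
      using i by auto
    ultimately show ?thesis
      using offset[of "- int i"] by (simp add: j)
  qed
  have g_near: "2 * i = g (- int i)" "i \<in> {1..n - \<nu>}" if "i \<in> {1..\<nu>}" for i
    using that two_\<nu> by (auto simp: g_def node_index_def)
  have g_far: "\<nu> + i = g (- int i)" "i \<in> {1..n - \<nu>}" if "i \<in> {\<nu> + 1..n - \<nu>}" for i
    using that by (auto simp: g_def node_index_def)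
  show ?thesis
    using centre above below[OF g_near(2,1)] below[OF g_far(2,1)]
    by (intro conjI ballI)
qed

end
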